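(* Let $M\subset\mathbb R^4$ be an embedded para-CR manifold and let $f=(u,v)\colon M\to\mathbb R^2$ be a para-CR function. Then $f$ extends in a unique way to a para-holomorphic function $\tilde f=(\tilde u,\tilde v)$ in some neighbourhood of $M$ in $\mathbb R^4$ (uniqueness meaning that any two such extensions agree in some neighbourhood of $M$).
   Context: All functions are smooth. Let $\mathbb R^4=\mathbb R^2_{xy}\times\mathbb R^2_{ab}$ with coordinates $(x,y)$ and $(a,b)$ on the two factors. An embedded para-CR manifold is a hypersurface $M\subset\mathbb R^4$ given (locally, near the origin) by an equation $y=a+\phi(a,b,x)$ with $\frac{\partial\phi}{\partial a}(0)=0$; the neighbourhood is taken small enough that $1+\frac{\partial \phi}{\partial a}$ does not vanish. It carries the two direction fields $TM\cap T\mathbb R^2_{xy}$ and $TM\cap T\mathbb R^2_{ab}$, spanned in the coordinates $(x,a,b)$ on $M$ by $X=\partial_x$ and $Y=(1+\frac{\partial\phi}{\partial a})\partial_b-\frac{\partial\phi}{\partial b}\partial_a$ respectively. A function $f=(u,v)\colon M\to\mathbb R^2$ is a para-CR function if $Xv=0$ and $Yu=0$. A function $\tilde f=(\tilde u,\tilde v)\colon D\to\mathbb R^2$ on an open set $D\subset\mathbb R^4$ is para-holomorphic if $\frac{\partial\tilde u}{\partial a}=\frac{\partial\tilde u}{\partial b}=0$ and $\frac{\partial\tilde v}{\partial x}=\frac{\partial\tilde v}{\partial y}=0$ on $D$. *)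

theory Defs
  imports "HOL-Analysis.Analysis"
begin

text \<open>Smoothness (all derivatives of all orders exist and are continuous) on an open set.\<close>

primrec ck_on :: "nat \<Rightarrow> 'a::euclidean_space set \<Rightarrow> ('a \<Rightarrow> 'b::real_normed_vector) \<Rightarrow> bool" where
  "ck_on 0 S g \<longleftrightarrow> continuous_on S g"
| "ck_on (Suc n) S g \<longleftrightarrow> (\<forall>p\<in>S. g differentiable (at p)) \<and>
     (\<forall>w. ck_on n S (\<lambda>p. frechet_derivative g (at p) w))"

definition smooth_on :: "'a::euclidean_space set \<Rightarrow> ('a \<Rightarrow> 'b::real_normed_vector) \<Rightarrow> bool" where
  "smooth_on S g \<longleftrightarrow> (\<forall>n. ck_on n S g)"

definition field_deriv ::
  "('a \<Rightarrow> 'a) \<Rightarrow> ('a::euclidean_space \<Rightarrow> 'b::real_normed_vector) \<Rightarrow> 'a \<Rightarrow> 'b" where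
  "field_deriv V g p = frechet_derivative g (at p) (V p)"

text \<open>Points of the ambient space are \<open>((x, y), (a, b))\<close>; the coordinates on the
  hypersurface are ordered as \<open>(a, b, x)\<close>, like the arguments of the defining function.\<close>

type_synonym ambient = "(real \<times> real) \<times> (real \<times> real)"
type_synonym coords = "real \<times> real \<times> real"

definition graph_param :: "(coords \<Rightarrow> real) \<Rightarrow> coords \<Rightarrow> ambient" where
  "graph_param \<phi> = (\<lambda>(a, b, x). ((x, a + \<phi> (a, b, x)), (a, b)))"

definition d_a :: "(coords \<Rightarrow> real) \<Rightarrow> coords \<Rightarrow> real" where
  "d_a = field_deriv (\<lambda>_. (1, 0, 0))"

definition d_b :: "(coords \<Rightarrow> real) \<Rightarrow> coords \<Rightarrow> real" where
  "d_b = field_deriv (\<lambda>_. (0, 1, 0))"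

definition embedded_para_CR :: "ambient set \<Rightarrow> coords set \<Rightarrow> (coords \<Rightarrow> real) \<Rightarrow> bool" where
  "embedded_para_CR M U \<phi> \<longleftrightarrow>
     open U \<and> 0 \<in> U \<and> smooth_on U \<phi> \<and>
     d_a \<phi> 0 = 0 \<and> (\<forall>p\<in>U. 1 + d_a \<phi> p \<noteq> 0) \<and>
     M = {((x, y), (a, b)) | x y a b. (a, b, x) \<in> U \<and> y = a + \<phi> (a, b, x)}"

definition X_field :: "coords \<Rightarrow> coords" where
  "X_field p = (0, 0, 1)"

definition Y_field :: "(coords \<Rightarrow> real) \<Rightarrow> coords \<Rightarrow> coords" where
  "Y_field \<phi> p = (- d_b \<phi> p, 1 + d_a \<phi> p, 0)"

text \<open>A function on the hypersurface is represented by a function on the ambient space of which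
  only the values on the hypersurface matter.\<close>

definition para_CR_function ::
  "coords set \<Rightarrow> (coords \<Rightarrow> real) \<Rightarrow> (ambient \<Rightarrow> real \<times> real) \<Rightarrow> bool" where
  "para_CR_function U \<phi> f \<longleftrightarrow>
     smooth_on U (f \<circ> graph_param \<phi>) \<and>
     (\<forall>p\<in>U. field_deriv X_field (snd \<circ> f \<circ> graph_param \<phi>) p = 0) \<and>
     (\<forall>p\<in>U. field_deriv (Y_field \<phi>) (fst \<circ> f \<circ> graph_param \<phi>) p = 0)"

definition para_holomorphic_on :: "ambient set \<Rightarrow> (ambient \<Rightarrow> real \<times> real) \<Rightarrow> bool" where
  "para_holomorphic_on D F \<longleftrightarrow>
     smooth_on D F \<and>
     (\<forall>p\<in>D. field_deriv (\<lambda>_. ((0, 0), (1, 0))) (fst \<circ> F) p = 0 \<and>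
            field_deriv (\<lambda>_. ((0, 0), (0, 1))) (fst \<circ> F) p = 0 \<and>
            field_deriv (\<lambda>_. ((1, 0), (0, 0))) (snd \<circ> F) p = 0 \<and>
            field_deriv (\<lambda>_. ((0, 1), (0, 0))) (snd \<circ> F) p = 0)"

definition para_holomorphic_extension ::
  "ambient set \<Rightarrow> (ambient \<Rightarrow> real \<times> real) \<Rightarrow> ambient set \<Rightarrow> (ambient \<Rightarrow> real \<times> real) \<Rightarrow> bool" where
  "para_holomorphic_extension M f D F \<longleftrightarrow>
     open D \<and> M \<subseteq> D \<and> para_holomorphic_on D F \<and> (\<forall>p\<in>M. F p = f p)"

end

theory Submission
  imports Defs
begin

text \<open>
  Write the hypersurface as \<open>y = h(a, b, x)\<close>. Since \<open>Xv = 0\<close>, the second component extends by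
  \<open>v(a, b, x)\<close>, independently of \<open>y\<close>. Solving \<open>y = h(s, b, x)\<close> for \<open>s\<close> near \<open>a\<close>, the first component
  extends by \<open>u(s, b, x)\<close>, and \<open>Yu = 0\<close> says precisely that this does not depend on \<open>b\<close>.
  To make the choice of \<open>s\<close> global, consider the tuples \<open>(s, a, b, x)\<close> for which the segment from
  \<open>(a, b, x)\<close> to \<open>(s, b, x)\<close> lies in \<open>U\<close>. On them \<open>(s, a, b, x) \<mapsto> ((x, h(s, b, x)), (a, b))\<close> is
  injective by Rolle's theorem, hence open by invariance of domain, and its inverse is smooth.
  Uniqueness holds because an extension is constant along segments joining \<open>((x, y), (a, b))\<close> to the
  hypersurface in the \<open>a\<close>-direction (first component) and in the \<open>y\<close>-direction (second component).
\<close>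

subsection \<open>Calculus of \<open>C\<^sup>k\<close> maps\<close>

lemma ck_on_SucI:
  assumes "\<And>p. p \<in> S \<Longrightarrow> (g has_derivative g' p) (at p)"
    and "\<And>w. ck_on n S (\<lambda>p. frechet_derivative g (at p) w)"
  shows "ck_on (Suc n) S g"
  using assms by (auto simp: differentiable_def)

lemma ck_on_SucD:
  assumes "ck_on (Suc n) S g"
  shows "p \<in> S \<Longrightarrow> (g has_derivative frechet_derivative g (at p)) (at p)"
    and "ck_on n S (\<lambda>p. frechet_derivative g (at p) w)"
  using assms by (auto simp: frechet_derivative_works)

text \<open>A derivative at \<open>p\<close> only sees a neighbourhood of \<open>p\<close>, which
  lies in the open set \<open>S\<close>. Hence the derivatives agree on \<open>S\<close> as well and
  the induction continues with them.\<close>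

lemma ck_on_cong:
  assumes "open S" "ck_on n S f" "\<And>p. p \<in> S \<Longrightarrow> f p = g p"
  shows "ck_on n S g"
  using assms(2,3)
proof (induction n arbitrary: f g)
  case 0
  then show ?case by (simp cong: continuous_on_cong)
next
  case (Suc n)
  have g: "(g has_derivative frechet_derivative f (at p)) (at p)" if "p \<in> S" for p
    using ck_on_SucD(1)[OF Suc.prems(1) that] assms(1) that Suc.prems(2)
    by (rule has_derivative_transform_within_open)
  show ?case
  proof (rule ck_on_SucI[OF g])
    fix w
    show "ck_on n S (\<lambda>p. frechet_derivative g (at p) w)"
      using ck_on_SucD(2)[OF Suc.prems(1), of w]
      by (rule Suc.IH) (simp add: frechet_derivative_at[OF g])
  qed
qed

text \<open>By uniqueness of derivatives, any explicit formula \<open>g'\<close> may stand in for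
  \<open>frechet_derivative g\<close>. The closure properties below all rest on this.\<close>

lemma ck_on_SucI':
  assumes "open S" "\<And>p. p \<in> S \<Longrightarrow> (g has_derivative g' p) (at p)"
    and "\<And>w. ck_on n S (\<lambda>p. g' p w)"
  shows "ck_on (Suc n) S g"
proof (rule ck_on_SucI[OF assms(2)])
  show "ck_on n S (\<lambda>p. frechet_derivative g (at p) w)" for w
    using assms(1) assms(3)[of w] by (rule ck_on_cong) (simp add: frechet_derivative_at[OF assms(2)])
qed

lemma ck_on_Suc_imp: "ck_on (Suc n) S g \<Longrightarrow> ck_on n S g"
proof (induction n arbitrary: g)
  case 0
  then show ?case
    by (auto intro!: differentiable_imp_continuous_on differentiable_at_imp_differentiable_on)
next
  case (Suc n)
  show ?case
    by (rule ck_on_SucI[OF ck_on_SucD(1)[OF Suc.prems] Suc.IH[OF ck_on_SucD(2)[OF Suc.prems]]])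
qed

lemma ck_on_const: "ck_on n S (\<lambda>_. c)"
  by (induction n arbitrary: c) (auto simp: frechet_derivative_const)

lemma ck_on_linear:
  assumes "open S" "bounded_linear L"
  shows "ck_on n S L"
proof (cases n)
  case 0
  then show ?thesis by (simp add: assms(2) linear_continuous_on)
next
  case (Suc m)
  show ?thesis
    unfolding Suc by (rule ck_on_SucI'[OF assms(1) bounded_linear_imp_has_derivative[OF assms(2)] ck_on_const])
qed

lemma ck_on_linear_compose:
  assumes "open S" "bounded_linear L" "ck_on n S g"
  shows "ck_on n S (\<lambda>p. L (g p))"
  using assms(3)
proof (induction n arbitrary: g)
  case 0
  then show ?case by (simp add: bounded_linear.continuous_on[OF assms(2)])
next
  case (Suc n)
  show ?case
    using ck_on_SucD[OF Suc.prems]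
    by (intro ck_on_SucI'[OF assms(1) bounded_linear.has_derivative[OF assms(2)]] Suc.IH)
qed

lemma ck_on_add:
  assumes "open S" "ck_on n S f" "ck_on n S g"
  shows "ck_on n S (\<lambda>p. f p + g p)"
  using assms(2,3)
proof (induction n arbitrary: f g)
  case 0
  then show ?case by (simp add: continuous_on_add)
next
  case (Suc n)
  show ?case
    using ck_on_SucD[OF Suc.prems(1)] ck_on_SucD[OF Suc.prems(2)]
    by (intro ck_on_SucI'[OF assms(1) has_derivative_add] Suc.IH)
qed

lemma ck_on_sum:
  assumes "open S" "\<And>i. i \<in> I \<Longrightarrow> ck_on n S (f i)"
  shows "ck_on n S (\<lambda>p. \<Sum>i\<in>I. f i p)"
  using assms(2)
  by (induction I rule: infinite_finite_induct) (auto intro: ck_on_const ck_on_add[OF assms(1)])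

text \<open>By the product rule the derivative is again a sum of values of \<open>B\<close>, each
  pairing one function with a derivative of the other, so the induction closes.\<close>

lemma ck_on_bilinear:
  assumes "open S" "bounded_bilinear B" "ck_on n S f" "ck_on n S g"
  shows "ck_on n S (\<lambda>p. B (f p) (g p))"
  using assms(3,4)
proof (induction n arbitrary: f g)
  case 0
  then show ?case by (simp add: bounded_bilinear.continuous_on[OF assms(2)])
next
  case (Suc n)
  show ?case
    using ck_on_SucD[OF Suc.prems(1)] ck_on_SucD[OF Suc.prems(2)]
    by (intro ck_on_SucI'[OF assms(1) bounded_bilinear.FDERIV[OF assms(2)]]
        ck_on_add[OF assms(1)] Suc.IH Suc.prems[THEN ck_on_Suc_imp])
qed

lemmas ck_on_mult = ck_on_bilinear[OF _ bounded_bilinear_mult]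

lemma ck_on_Pair:
  assumes "open S" "ck_on n S f" "ck_on n S g"
  shows "ck_on n S (\<lambda>p. (f p, g p))"
  using ck_on_add[OF assms(1)
      ck_on_linear_compose[OF assms(1) bounded_linear_Pair[OF bounded_linear_ident bounded_linear_zero] assms(2)]
      ck_on_linear_compose[OF assms(1) bounded_linear_Pair[OF bounded_linear_zero bounded_linear_ident] assms(3)]]
  by simp

text \<open>The derivative of \<open>1/f\<close> is \<open>-(1/f) f' (1/f)\<close>: a product
  involving only \<open>f'\<close> and \<open>1/f\<close>, and the latter is covered by the
  induction hypothesis.\<close>

lemma ck_on_inverse:
  fixes f :: "'a::euclidean_space \<Rightarrow> real"
  assumes "open S" "\<And>p. p \<in> S \<Longrightarrow> f p \<noteq> 0" "ck_on n S f"
  shows "ck_on n S (\<lambda>p. inverse (f p))"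
  using assms(3)
proof (induction n)
  case 0
  then show ?case by (simp add: assms(2) continuous_on_inverse)
next
  case (Suc n)
  show ?case
  proof (rule ck_on_SucI'[OF assms(1)])
    show "((\<lambda>p. inverse (f p)) has_derivative
        (\<lambda>w. - (inverse (f p) * frechet_derivative f (at p) w * inverse (f p)))) (at p)"
      if "p \<in> S" for p
      using assms(2)[OF that] ck_on_SucD(1)[OF Suc.prems that] by (rule Deriv.has_derivative_inverse)
    show "ck_on n S (\<lambda>p. - (inverse (f p) * frechet_derivative f (at p) w * inverse (f p)))" for w
      using ck_on_SucD(2)[OF Suc.prems] Suc.IH[OF ck_on_Suc_imp[OF Suc.prems]]
      by (intro ck_on_linear_compose[OF assms(1) bounded_linear_minus[OF bounded_linear_ident]]
          ck_on_mult assms(1))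
  qed
qed

text \<open>In the chain rule the derivative of \<open>g\<close> is applied to a direction that
  varies with \<open>p\<close>, while \<open>ck_on\<close> speaks of fixed directions only.
  Expanding that direction in \<open>Basis\<close> leaves fixed directions with variable scalar
  coefficients.\<close>

lemma ck_on_compose:
  fixes f :: "'a::euclidean_space \<Rightarrow> 'b::euclidean_space"
  assumes "open S" "f ` S \<subseteq> T" "ck_on n S f" "ck_on n T g"
  shows "ck_on n S (\<lambda>p. g (f p))"
  using assms(3,4)
proof (induction n arbitrary: g)
  case 0
  then show ?case using assms(2) by (auto intro: continuous_on_compose2)
next
  case (Suc n)
  let ?f' = "\<lambda>p. frechet_derivative f (at p)" and ?g' = "\<lambda>q. frechet_derivative g (at q)"
  have g': "(g has_derivative ?g' (f p)) (at (f p))" if "p \<in> S" for p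
    using ck_on_SucD(1)[OF Suc.prems(2)] assms(2) that by blast
  have "((\<lambda>p. g (f p)) has_derivative (\<lambda>w. \<Sum>i\<in>Basis. (?f' p w \<bullet> i) *\<^sub>R ?g' (f p) i)) (at p)"
    if "p \<in> S" for p
  proof -
    interpret bounded_linear "?g' (f p)"
      using g'[OF that] by (rule has_derivative_bounded_linear)
    have "?g' (f p) (?f' p w) = (\<Sum>i\<in>Basis. (?f' p w \<bullet> i) *\<^sub>R ?g' (f p) i)" for w
      by (subst (1) euclidean_representation[of "?f' p w", symmetric]) (simp add: sum scaleR)
    then show ?thesis
      using has_derivative_compose[OF ck_on_SucD(1)[OF Suc.prems(1) that] g'[OF that]] by simp
  qed
  then show ?case
  proof (rule ck_on_SucI'[OF assms(1)])
    show "ck_on n S (\<lambda>p. \<Sum>i\<in>Basis. (?f' p w \<bullet> i) *\<^sub>R ?g' (f p) i)" for w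
      by (intro ck_on_sum ck_on_bilinear[OF _ bounded_bilinear_scaleR] assms(1)
          ck_on_linear_compose[OF _ bounded_linear_inner_left ck_on_SucD(2)[OF Suc.prems(1)]]
          Suc.IH[OF ck_on_Suc_imp[OF Suc.prems(1)] ck_on_SucD(2)[OF Suc.prems(2)]])
  qed
qed

text \<open>This is the tube lemma: an open set containing \<open>{z} \<times> K\<close> contains
  \<open>Z \<times> K\<close> for some neighbourhood \<open>Z\<close> of \<open>z\<close>. It is
  used for families of segments, with \<open>K\<close> the unit interval.\<close>

lemma open_all_compact:
  fixes c :: "'a::topological_space \<Rightarrow> 'b::topological_space \<Rightarrow> 'c::topological_space"
  assumes "open E" "compact K" "open D" "continuous_on (E \<times> K) (\<lambda>(z, t). c z t)"
  shows "open {z \<in> E. \<forall>t\<in>K. c z t \<in> D}"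
proof (rule topological_space_class.openI)
  fix z assume "z \<in> {z \<in> E. \<forall>t\<in>K. c z t \<in> D}"
  then have z: "z \<in> E" "\<And>t. t \<in> K \<Longrightarrow> c z t \<in> D" by auto
  obtain W where W: "open W" "W \<inter> (E \<times> K) = (\<lambda>(z, t). c z t) -` D \<inter> (E \<times> K)"
    using assms(3,4) unfolding continuous_on_open_invariant by metis
  have "{z} \<times> K \<subseteq> W"
  proof
    fix q assume "q \<in> {z} \<times> K"
    then have "q \<in> (\<lambda>(z, t). c z t) -` D \<inter> (E \<times> K)" using z by auto
    then show "q \<in> W" using W(2) by blast
  qed
  then obtain Z where Z: "z \<in> Z" "open Z" "Z \<times> K \<subseteq> W"
    using Elementary_Topology.tube_lemma[OF assms(2) W(1)] by blast
  have "c z' t \<in> D" if "z' \<in> Z \<inter> E" "t \<in> K" for z' t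
  proof -
    have "(z', t) \<in> W \<inter> (E \<times> K)" using that Z(3) by auto
    then show ?thesis unfolding W(2) by simp
  qed
  then show "\<exists>T. open T \<and> z \<in> T \<and> T \<subseteq> {z \<in> E. \<forall>t\<in>K. c z t \<in> D}"
    using Z z(1) assms(1) by (intro exI[of _ "Z \<inter> E"]) auto
qed

text \<open>Mean value theorem for \<open>g\<close> restricted to the segment. The length
  \<open>r\<close> is kept apart from the direction \<open>e\<close> so that the hypothesis concerns
  a constant coordinate field, whatever the sign of \<open>r\<close>.\<close>

lemma eq_along_segment:
  fixes g :: "'a::euclidean_space \<Rightarrow> real"
  assumes g: "\<And>t. t \<in> {0..1} \<Longrightarrow> g differentiable (at (p + t *\<^sub>R r *\<^sub>R e))"
    and zero: "\<And>t. t \<in> {0..1} \<Longrightarrow> field_deriv (\<lambda>_. e) g (p + t *\<^sub>R r *\<^sub>R e) = 0"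
  shows "g (p + r *\<^sub>R e) = g p"
proof -
  have *: "((\<lambda>t. g (p + t *\<^sub>R r *\<^sub>R e)) has_derivative (\<lambda>h. 0)) (at t)" if "t \<in> {0..1}" for t
  proof -
    let ?g' = "frechet_derivative g (at (p + t *\<^sub>R r *\<^sub>R e))"
    have g': "(g has_derivative ?g') (at (p + t *\<^sub>R r *\<^sub>R e))"
      using g[OF that] by (simp add: frechet_derivative_works)
    have "((\<lambda>t. g (p + t *\<^sub>R r *\<^sub>R e)) has_derivative (\<lambda>h. ?g' (h *\<^sub>R r *\<^sub>R e))) (at t)"
      by (rule has_derivative_compose[where f = "\<lambda>t. p + t *\<^sub>R r *\<^sub>R e" and g = g, OF _ g'])
        (auto intro!: derivative_eq_intros)
    then show ?thesis
      using zero[OF that] linear_scale[OF has_derivative_linear[OF g']] by (simp add: field_deriv_def)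
  qed
  have "\<exists>x\<in>{0<..<1::real}. g (p + 1 *\<^sub>R r *\<^sub>R e) - g (p + 0 *\<^sub>R r *\<^sub>R e) = 0"
    by (rule mvt_simple[where f = "\<lambda>t. g (p + t *\<^sub>R r *\<^sub>R e)"])
      (simp, rule has_derivative_at_withinI[OF *], simp)
  then show ?thesis by simp
qed

subsection \<open>Solving the defining equation for \<open>a\<close>\<close>

type_synonym lift = "real \<times> real \<times> real \<times> real"

locale para_CR_hypersurface =
  fixes M :: "ambient set" and U :: "coords set" and \<phi> :: "coords \<Rightarrow> real"
  assumes embedded: "embedded_para_CR M U \<phi>"
begin

definition height :: "coords \<Rightarrow> real" where
  "height q = fst q + \<phi> q"

abbreviation dheight :: "coords \<Rightarrow> coords \<Rightarrow> real" where
  "dheight q \<equiv> frechet_derivative height (at q)"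

definition foot :: "lift \<Rightarrow> coords" where
  "foot = (\<lambda>(s, a, b, x). (s, b, x))"

text \<open>The whole segment is required because \<open>U\<close> need not be convex: two endpoints
  in \<open>U\<close> would not suffice for Rolle's theorem.\<close>

definition lifts :: "lift set" where
  "lifts = {(s, a, b, x). \<forall>t\<in>{0..1}. (a + t * (s - a), b, x) \<in> U}"

definition proj :: "lift \<Rightarrow> ambient" where
  "proj = (\<lambda>(s, a, b, x). ((x, height (s, b, x)), (a, b)))"

definition dproj :: "lift \<Rightarrow> lift \<Rightarrow> ambient" where
  "dproj z = (\<lambda>(s, a, b, x). ((x, dheight (foot z) (s, b, x)), (a, b)))"

definition nbhd :: "ambient set" where
  "nbhd = proj ` lifts"

definition lift_of :: "ambient \<Rightarrow> lift" where
  "lift_of = inv_into lifts proj"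

text \<open>When \<open>foot z\<close> is in \<open>U\<close>, this is the inverse of
  \<open>dproj z\<close>. The first entry solves \<open>y = h_a s + h_b b + h_x x\<close> for
  \<open>s\<close>, where \<open>h_a\<close>, \<open>h_b\<close>, \<open>h_x\<close> are the partial
  derivatives of \<open>height\<close> at \<open>foot z\<close>.\<close>

definition dlift :: "lift \<Rightarrow> ambient \<Rightarrow> lift" where
  "dlift z = (\<lambda>((x, y), (a, b)).
     (inverse (dheight (foot z) (1, 0, 0)) *
        (y - b * dheight (foot z) (0, 1, 0) - x * dheight (foot z) (0, 0, 1)), a, b, x))"

lemma open_U: "open U"
  using embedded by (simp add: embedded_para_CR_def)

lemma M_eq: "M = {((x, height (a, b, x)), (a, b)) | x a b. (a, b, x) \<in> U}"
  using embedded by (auto simp: embedded_para_CR_def height_def)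

lemma ck_on_height: "ck_on n U height"
proof -
  have "ck_on n U \<phi>"
    using embedded by (simp add: embedded_para_CR_def smooth_on_def)
  then have "ck_on n U (\<lambda>q. fst q + \<phi> q)"
    by (intro ck_on_add[OF open_U] ck_on_linear[OF open_U bounded_linear_fst])
  then show ?thesis by (simp add: height_def[abs_def])
qed

lemma has_derivative_height: "q \<in> U \<Longrightarrow> (height has_derivative dheight q) (at q)"
  using ck_on_SucD(1)[OF ck_on_height[of "Suc 0"]] .

lemma dheight_eq:
  assumes "q \<in> U"
  shows "dheight q w = fst w + frechet_derivative \<phi> (at q) w"
proof -
  have "ck_on (Suc 0) U \<phi>"
    using embedded unfolding embedded_para_CR_def smooth_on_def by blast
  from ck_on_SucD(1)[OF this assms]
  have "(height has_derivative (\<lambda>w. fst w + frechet_derivative \<phi> (at q) w)) (at q)"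
    unfolding height_def[abs_def] by (intro has_derivative_add has_derivative_fst has_derivative_ident)
  from frechet_derivative_at[OF this] show ?thesis by metis
qed

text \<open>In terms of \<open>height\<close>, the field \<open>Y\<close> thus has the components
  \<open>(- h_b, h_a, 0)\<close>, and the nondegeneracy assumption says that \<open>h_a\<close> does
  not vanish.\<close>

lemma dheight_a: "q \<in> U \<Longrightarrow> dheight q (1, 0, 0) = 1 + d_a \<phi> q"
  and dheight_b: "q \<in> U \<Longrightarrow> dheight q (0, 1, 0) = d_b \<phi> q"
  by (simp_all add: dheight_eq d_a_def d_b_def field_deriv_def)

lemma dheight_a_nonzero: "q \<in> U \<Longrightarrow> dheight q (1, 0, 0) \<noteq> 0"
  using embedded by (simp add: dheight_a embedded_para_CR_def)

lemma linear_coords_expand: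
  fixes L :: "coords \<Rightarrow> real"
  assumes "linear L"
  shows "L (s, b, x) = s * L (1, 0, 0) + b * L (0, 1, 0) + x * L (0, 0, 1)"
proof -
  have "(s, b, x) = s *\<^sub>R (1, 0, 0) + b *\<^sub>R (0, 1, 0) + x *\<^sub>R (0, 0, 1 :: real)"
    by simp
  then show ?thesis
    by (simp only: linear_add[OF assms] linear_scale[OF assms]) simp
qed

section \<open>The domain \<open>lifts\<close> and the injectivity of \<open>proj\<close>\<close>

lemma open_lifts: "open lifts"
proof -
  have "open {z \<in> UNIV. \<forall>t\<in>{0..1}. (case z of (s, a, b, x) \<Rightarrow> (a + t * (s - a), b, x)) \<in> U}"
    by (rule open_all_compact) (auto intro!: open_U continuous_intros simp: case_prod_unfold)
  also have "{z \<in> UNIV. \<forall>t\<in>{0..1}. (case z of (s, a, b, x) \<Rightarrow> (a + t * (s - a), b, x)) \<in> U} = lifts"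
    by (auto simp: lifts_def)
  finally show ?thesis .
qed

lemma lifts_segment:
  assumes "(s, a, b, x) \<in> lifts" "r \<in> closed_segment a s"
  shows "(r, b, x) \<in> U"
proof -
  obtain t where "t \<in> {0..1}" "r = a + t * (s - a)"
    using assms(2) by (auto simp: in_segment algebra_simps)
  then show ?thesis using assms(1) by (auto simp: lifts_def)
qed

lemma foot_in_U: "z \<in> lifts \<Longrightarrow> foot z \<in> U"
  by (cases z) (auto simp: foot_def intro: lifts_segment)

lemma base_in_U: "(s, a, b, x) \<in> lifts \<Longrightarrow> (a, b, x) \<in> U"
  by (erule lifts_segment) simp

lemma bounded_linear_foot: "bounded_linear foot"
  unfolding foot_def case_prod_unfold
  by (intro bounded_linear_intros)

lemma has_derivative_proj:
  assumes "z \<in> lifts"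
  shows "(proj has_derivative dproj z) (at z)"
proof -
  have "((\<lambda>z. height (foot z)) has_derivative (\<lambda>w. dheight (foot z) (foot w))) (at z)"
    by (rule has_derivative_compose[OF bounded_linear_imp_has_derivative[OF bounded_linear_foot]
          has_derivative_height[OF foot_in_U[OF assms]]])
  then have "((\<lambda>z. ((snd (snd (snd z)), height (foot z)), (fst (snd z), fst (snd (snd z))))) has_derivative
    (\<lambda>w. ((snd (snd (snd w)), dheight (foot z) (foot w)), (fst (snd w), fst (snd (snd w)))))) (at z)"
    by (intro has_derivative_Pair has_derivative_fst has_derivative_snd has_derivative_ident)
  then show ?thesis
    by (simp add: proj_def dproj_def foot_def case_prod_unfold)
qed

text \<open>Equal values at both ends would make the partial derivative \<open>h_a\<close> vanish at
  some point in between, which \<open>dheight_a_nonzero\<close> excludes.\<close>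

lemma height_inj_on_segment:
  assumes "s < s'" "\<And>r. r \<in> {s..s'} \<Longrightarrow> (r, b, x) \<in> U"
  shows "height (s, b, x) \<noteq> height (s', b, x)"
proof
  assume eq: "height (s, b, x) = height (s', b, x)"
  have *: "((\<lambda>r. height (r, b, x)) has_derivative (\<lambda>h. dheight (r, b, x) (h, 0, 0))) (at r)"
    if "r \<in> {s..s'}" for r
    by (rule has_derivative_compose[where f = "\<lambda>r. (r, b, x)" and g = height, OF _ has_derivative_height[OF assms(2)[OF that]]])
      (auto intro!: derivative_eq_intros simp: zero_prod_def)
  have "\<exists>r\<in>{s<..<s'}. height (s', b, x) - height (s, b, x) = dheight (r, b, x) (s' - s, 0, 0)"
    by (rule mvt_simple[OF assms(1)]) (auto intro!: has_derivative_at_withinI *)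
  then obtain r where r: "r \<in> {s<..<s'}" "dheight (r, b, x) (s' - s, 0, 0) = 0"
    using eq by auto
  then have "(r, b, x) \<in> U" using assms(2) by auto
  with r(2) show False
    using dheight_a_nonzero assms(1)
      linear_coords_expand[OF has_derivative_linear[OF has_derivative_height], of "(r, b, x)" "s' - s" 0 0]
    by simp
qed

text \<open>Two lifts with the same image share \<open>a\<close>, \<open>b\<close>, \<open>x\<close>
  and differ at most in \<open>s\<close>. Both segments start at \<open>a\<close>, so together they
  cover everything between \<open>s\<close> and \<open>s'\<close>, and \<open>height\<close> is
  injective there.\<close>

lemma inj_on_proj: "inj_on proj lifts"
proof -
  have *: "\<not> s < s'"
    if "(s, a, b, x) \<in> lifts" "(s', a, b, x) \<in> lifts" "height (s, b, x) = height (s', b, x)"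
    for s s' a b x
  proof
    assume "s < s'"
    moreover have "(r, b, x) \<in> U" if "r \<in> {s..s'}" for r
    proof (cases "r \<le> a")
      case True
      then show ?thesis using lifts_segment[OF \<open>(s, a, b, x) \<in> lifts\<close>] that
        by (simp add: closed_segment_eq_real_ivl split: if_splits)
    next
      case False
      then show ?thesis using lifts_segment[OF \<open>(s', a, b, x) \<in> lifts\<close>] that
        by (simp add: closed_segment_eq_real_ivl split: if_splits)
    qed
    ultimately show False using height_inj_on_segment that(3) by blast
  qed
  show ?thesis
  proof (rule inj_onI)
    fix z z' assume z: "z \<in> lifts" "z' \<in> lifts" "proj z = proj z'"
    obtain s a b x where "z = (s, a, b, x)" by (cases z)
    moreover obtain s' a' b' x' where "z' = (s', a', b', x')" by (cases z')
    ultimately show "z = z'"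
      using z *[of s a b x s'] *[of s' a b x s] by (auto simp: proj_def)
  qed
qed

section \<open>The open image of \<open>proj\<close> and its smooth inverse\<close>

lemma continuous_on_proj: "continuous_on lifts proj"
  by (rule has_derivative_continuous_on[OF has_derivative_at_withinI[OF has_derivative_proj]])

text \<open>Invariance of domain applies, as both spaces have dimension 4. Arbitrary open subsets
  are allowed because uniqueness needs a smaller set than \<open>lifts\<close>.\<close>

lemma open_proj_image: "open S \<Longrightarrow> S \<subseteq> lifts \<Longrightarrow> open (proj ` S)"
  by (rule invariance_of_domain_gen)
    (auto intro: continuous_on_subset[OF continuous_on_proj] inj_on_subset[OF inj_on_proj])

lemma open_nbhd: "open nbhd"
  unfolding nbhd_def by (rule open_proj_image[OF open_lifts subset_refl])

lemma lift_of_proj: "z \<in> lifts \<Longrightarrow> lift_of (proj z) = z"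
  unfolding lift_of_def by (rule inv_into_f_f[OF inj_on_proj])

lemma lift_of_in: "p \<in> nbhd \<Longrightarrow> lift_of p \<in> lifts"
  and proj_lift_of: "p \<in> nbhd \<Longrightarrow> proj (lift_of p) = p"
  unfolding nbhd_def lift_of_def by (rule inv_into_into, assumption) (rule f_inv_into_f)

lemma continuous_on_lift_of: "continuous_on nbhd lift_of"
  unfolding nbhd_def
  by (rule continuous_on_inverse_open) (auto simp: open_lifts continuous_on_proj lift_of_proj)

text \<open>A continuous inverse is differentiable as soon as the derivative of \<open>proj\<close>
  has a bounded left inverse. That \<open>dlift\<close> is one comes down to dividing by
  \<open>h_a\<close>.\<close>

lemma has_derivative_lift_of:
  assumes "p \<in> nbhd"
  shows "(lift_of has_derivative dlift (lift_of p)) (at p)"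
proof (rule has_derivative_inverse_basic[where f = proj and g = lift_of and y = p, OF has_derivative_proj[OF lift_of_in[OF assms]] _ _ _ open_nbhd assms])
  show "bounded_linear (dlift (lift_of p))"
    unfolding dlift_def case_prod_unfold by (intro bounded_linear_intros)
  have U: "foot (lift_of p) \<in> U" by (intro foot_in_U lift_of_in assms)
  note * = linear_coords_expand[OF has_derivative_linear[OF has_derivative_height[OF U]]]
  have "dlift (lift_of p) (dproj (lift_of p) (s, a, b, x)) = (s, a, b, x)" for s a b x
    using dheight_a_nonzero[OF U] by (simp add: dlift_def dproj_def *[of s b x] field_simps)
  then show "dlift (lift_of p) \<circ> dproj (lift_of p) = id"
    by auto
  show "continuous (at p) lift_of"
    using continuous_on_lift_of open_nbhd assms by (simp add: continuous_on_eq_continuous_at)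
qed (rule proj_lift_of)

text \<open>Bootstrapping: the derivative of \<open>lift_of\<close> is a rational expression in the
  partial derivatives of \<open>height\<close> at \<open>foot (lift_of p)\<close>. If
  \<open>lift_of\<close> is of class \<open>n\<close>, so is this expression, and
  \<open>lift_of\<close> is of class \<open>n + 1\<close>.\<close>

lemma ck_on_lift_of: "ck_on n nbhd lift_of"
proof (induction n)
  case 0
  then show ?case by (simp add: continuous_on_lift_of)
next
  case (Suc n)
  have foot: "ck_on n nbhd (\<lambda>p. foot (lift_of p))"
    by (rule ck_on_linear_compose[OF open_nbhd bounded_linear_foot Suc])
  have *: "ck_on n nbhd (\<lambda>p. dheight (foot (lift_of p)) w)" for w
    by (rule ck_on_compose[OF open_nbhd _ foot ck_on_SucD(2)[OF ck_on_height]])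
      (intro image_subsetI foot_in_U lift_of_in)
  show ?case
  proof (rule ck_on_SucI'[OF open_nbhd has_derivative_lift_of])
    fix w :: ambient
    obtain x y a b where w: "w = ((x, y), (a, b))" by (cases w) auto
    have "ck_on n nbhd (\<lambda>p. y + ((- b) * dheight (foot (lift_of p)) (0, 1, 0)
        + (- x) * dheight (foot (lift_of p)) (0, 0, 1)))"
      by (intro ck_on_add ck_on_mult ck_on_const open_nbhd *)
    then have "ck_on n nbhd (\<lambda>p. (inverse (dheight (foot (lift_of p)) (1, 0, 0)) *
        (y + ((- b) * dheight (foot (lift_of p)) (0, 1, 0)
        + (- x) * dheight (foot (lift_of p)) (0, 0, 1))), a, b, x))"
      by (intro ck_on_Pair ck_on_mult ck_on_inverse ck_on_const open_nbhd * dheight_a_nonzero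
          foot_in_U lift_of_in)
    then show "ck_on n nbhd (\<lambda>p. dlift (lift_of p) w)"
      by (simp add: dlift_def w algebra_simps)
  qed
qed

lemma trivial_lift: "(a, b, x) \<in> U \<Longrightarrow> (a, a, b, x) \<in> lifts"
  by (simp add: lifts_def)

lemma M_subset_nbhd: "M \<subseteq> nbhd"
  unfolding M_eq nbhd_def using trivial_lift by (force simp: proj_def)

end

subsection \<open>Extension of para-CR functions\<close>

locale para_CR_map = para_CR_hypersurface +
  fixes f :: "ambient \<Rightarrow> real \<times> real"
  assumes para_CR: "para_CR_function U \<phi> f"
begin

definition u :: "coords \<Rightarrow> real" where
  "u = fst \<circ> f \<circ> graph_param \<phi>"

definition v :: "coords \<Rightarrow> real" where
  "v = snd \<circ> f \<circ> graph_param \<phi>"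

text \<open>For \<open>p = ((x, y), (a, b))\<close> in \<open>nbhd\<close>, \<open>u\<close> is read
  at the point of \<open>M\<close> sharing \<open>x\<close>, \<open>y\<close>, \<open>b\<close> with
  \<open>p\<close>, and \<open>v\<close> at the one sharing \<open>x\<close>, \<open>a\<close>,
  \<open>b\<close>.\<close>

definition extension :: "ambient \<Rightarrow> real \<times> real" where
  "extension p = (u (foot (lift_of p)), v (snd (lift_of p)))"

lemma graph_param_height: "graph_param \<phi> (a, b, x) = ((x, height (a, b, x)), (a, b))"
  by (simp add: graph_param_def height_def)

lemma graph_param_in_M: "q \<in> U \<Longrightarrow> graph_param \<phi> q \<in> M"
  by (cases q) (auto simp: graph_param_height M_eq)

lemma ck_on_u: "ck_on n U u" and ck_on_v: "ck_on n U v"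
proof -
  have "ck_on n U (\<lambda>q. f (graph_param \<phi> q))"
    using para_CR by (simp add: para_CR_function_def smooth_on_def comp_def)
  then show "ck_on n U u" "ck_on n U v"
    by (auto simp: u_def v_def comp_def intro: ck_on_linear_compose[OF open_U bounded_linear_fst]
        ck_on_linear_compose[OF open_U bounded_linear_snd])
qed

lemma has_derivative_u: "q \<in> U \<Longrightarrow> (u has_derivative frechet_derivative u (at q)) (at q)"
  using ck_on_SucD(1)[OF ck_on_u[of "Suc 0"]] .

lemma has_derivative_v: "q \<in> U \<Longrightarrow> (v has_derivative frechet_derivative v (at q)) (at q)"
  using ck_on_SucD(1)[OF ck_on_v[of "Suc 0"]] .

lemma X_v: "q \<in> U \<Longrightarrow> frechet_derivative v (at q) (0, 0, 1) = 0"
  using para_CR by (simp add: para_CR_function_def field_deriv_def X_field_def v_def)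

lemma Y_u: "q \<in> U \<Longrightarrow> frechet_derivative u (at q) (- dheight q (0, 1, 0), dheight q (1, 0, 0), 0) = 0"
  using para_CR
  by (simp add: para_CR_function_def field_deriv_def Y_field_def u_def dheight_a dheight_b)

lemma base_lift_of: "p \<in> nbhd \<Longrightarrow> snd (lift_of p) \<in> U"
  using lift_of_in[of p] base_in_U by (cases "lift_of p") auto

lemma foot_lift_of: "p \<in> nbhd \<Longrightarrow> foot (lift_of p) \<in> U"
  by (intro foot_in_U lift_of_in)

lemma ck_on_extension: "ck_on n nbhd extension"
proof -
  have "ck_on n nbhd (\<lambda>p. u (foot (lift_of p)))"
    by (rule ck_on_compose[OF open_nbhd _ ck_on_linear_compose[OF open_nbhd bounded_linear_foot ck_on_lift_of] ck_on_u])
      (intro image_subsetI foot_lift_of)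
  moreover have "ck_on n nbhd (\<lambda>p. v (snd (lift_of p)))"
    by (rule ck_on_compose[OF open_nbhd _ ck_on_linear_compose[OF open_nbhd bounded_linear_snd ck_on_lift_of] ck_on_v])
      (intro image_subsetI base_lift_of)
  ultimately show ?thesis
    unfolding extension_def[abs_def] by (rule ck_on_Pair[OF open_nbhd])
qed

section \<open>Para-holomorphy of the extension\<close>

lemma field_deriv_fst_extension:
  assumes "p \<in> nbhd"
  shows "field_deriv (\<lambda>_. w) (fst \<circ> extension) p =
    frechet_derivative u (at (foot (lift_of p))) (foot (dlift (lift_of p) w))"
proof -
  have "((\<lambda>p. foot (lift_of p)) has_derivative (\<lambda>w. foot (dlift (lift_of p) w))) (at p)"
    by (rule bounded_linear.has_derivative[OF bounded_linear_foot has_derivative_lift_of[OF assms]])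
  from has_derivative_compose[OF this has_derivative_u[OF foot_lift_of[OF assms]]]
  have "(fst \<circ> extension has_derivative
      (\<lambda>w. frechet_derivative u (at (foot (lift_of p))) (foot (dlift (lift_of p) w)))) (at p)"
    by (simp add: extension_def comp_def)
  then show ?thesis
    unfolding field_deriv_def by (simp add: frechet_derivative_at[symmetric])
qed

lemma field_deriv_snd_extension:
  assumes "p \<in> nbhd"
  shows "field_deriv (\<lambda>_. w) (snd \<circ> extension) p =
    frechet_derivative v (at (snd (lift_of p))) (snd (dlift (lift_of p) w))"
proof -
  have "((\<lambda>p. snd (lift_of p)) has_derivative (\<lambda>w. snd (dlift (lift_of p) w))) (at p)"
    by (rule has_derivative_snd[OF has_derivative_lift_of[OF assms]])
  from has_derivative_compose[OF this has_derivative_v[OF base_lift_of[OF assms]]]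
  have "(snd \<circ> extension has_derivative
      (\<lambda>w. frechet_derivative v (at (snd (lift_of p))) (snd (dlift (lift_of p) w)))) (at p)"
    by (simp add: extension_def comp_def)
  then show ?thesis
    unfolding field_deriv_def by (simp add: frechet_derivative_at[symmetric])
qed

text \<open>Moving \<open>a\<close> leaves the foot fixed and moving \<open>b\<close> shifts it
  along \<open>Y\<close>, where \<open>u\<close> has derivative zero. Moving \<open>y\<close> leaves
  \<open>(a, b, x)\<close> fixed and moving \<open>x\<close> shifts it along \<open>X\<close>, where
  \<open>v\<close> has derivative zero.\<close>

lemma para_holomorphic_on_extension: "para_holomorphic_on nbhd extension"
  unfolding para_holomorphic_on_def
proof (intro conjI ballI)
  show "smooth_on nbhd extension"
    by (simp add: smooth_on_def ck_on_extension)
  fix p assume p: "p \<in> nbhd"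
  let ?q = "foot (lift_of p)"
  have q: "?q \<in> U" using p by (rule foot_lift_of)
  note lu = has_derivative_linear[OF has_derivative_u[OF q]]
  note lv = has_derivative_linear[OF has_derivative_v[OF base_lift_of[OF p]]]
  show "field_deriv (\<lambda>_. ((0, 0), (1, 0))) (fst \<circ> extension) p = 0"
    using linear_0[OF lu] by (simp add: field_deriv_fst_extension[OF p] dlift_def foot_def zero_prod_def)
  \<comment> \<open>Implicit differentiation of \<open>y = h(s, b, x)\<close> in \<open>b\<close>
    gives \<open>ds/db = - h_b / h_a\<close>, so the foot moves in the direction
    \<open>Y / h_a\<close>.\<close>
  have "foot (dlift (lift_of p) ((0, 0), (0, 1))) =
      inverse (dheight ?q (1, 0, 0)) *\<^sub>R (- dheight ?q (0, 1, 0), dheight ?q (1, 0, 0), 0)"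
    using dheight_a_nonzero[OF q] by (simp add: dlift_def foot_def)
  then show "field_deriv (\<lambda>_. ((0, 0), (0, 1))) (fst \<circ> extension) p = 0"
    by (simp only: field_deriv_fst_extension[OF p] linear_scale[OF lu] Y_u[OF q]) simp
  show "field_deriv (\<lambda>_. ((1, 0), (0, 0))) (snd \<circ> extension) p = 0"
    using X_v[OF base_lift_of[OF p]] by (simp add: field_deriv_snd_extension[OF p] dlift_def)
  show "field_deriv (\<lambda>_. ((0, 1), (0, 0))) (snd \<circ> extension) p = 0"
    using linear_0[OF lv] by (simp add: field_deriv_snd_extension[OF p] dlift_def zero_prod_def)
qed

lemma extension_on_M: "p \<in> M \<Longrightarrow> extension p = f p"
proof -
  assume "p \<in> M"
  then obtain a b x where p: "p = ((x, height (a, b, x)), (a, b))" "(a, b, x) \<in> U"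
    unfolding M_eq by blast
  \<comment> \<open>On \<open>M\<close> the solution is \<open>s = a\<close>, so both evaluation
    points coincide.\<close>
  have "lift_of p = (a, a, b, x)"
    using lift_of_proj[OF trivial_lift[OF p(2)]] by (simp add: proj_def p(1))
  then show ?thesis
    by (simp add: extension_def foot_def u_def v_def graph_param_height p(1))
qed

lemma extension_exists: "para_holomorphic_extension M f nbhd extension"
  by (simp add: para_holomorphic_extension_def open_nbhd M_subset_nbhd
      para_holomorphic_on_extension extension_on_M)

section \<open>Uniqueness: segments from \<open>proj z\<close> to the hypersurface\<close>

definition ab_segment :: "lift \<Rightarrow> real \<Rightarrow> ambient" where
  "ab_segment z t = proj z + t *\<^sub>R (fst z - fst (snd z)) *\<^sub>R ((0, 0), (1, 0))"

definition xy_segment :: "lift \<Rightarrow> real \<Rightarrow> ambient" where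
  "xy_segment z t = proj z + t *\<^sub>R (height (snd z) - height (foot z)) *\<^sub>R ((0, 1), (0, 0))"

lemma ab_segment_1: "ab_segment z 1 = graph_param \<phi> (foot z)"
  by (cases z) (simp add: ab_segment_def proj_def foot_def graph_param_height)

lemma xy_segment_1: "xy_segment z 1 = graph_param \<phi> (snd z)"
  by (cases z) (simp add: xy_segment_def proj_def foot_def graph_param_height)

text \<open>Each component of \<open>F\<close> is constant along its own segment, which ends on
  \<open>M\<close>, where \<open>F\<close> equals \<open>f\<close>. The resulting value involves
  neither \<open>F\<close> nor \<open>D\<close>, so any two extensions agree at such points.\<close>

lemma para_holomorphic_extension_proj:
  assumes F: "para_holomorphic_extension M f D F" and z: "z \<in> lifts"
    and ab: "\<And>t. t \<in> {0..1} \<Longrightarrow> ab_segment z t \<in> D"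
    and xy: "\<And>t. t \<in> {0..1} \<Longrightarrow> xy_segment z t \<in> D"
  shows "F (proj z) = (u (foot z), v (snd z))"
proof -
  have D: "open D" and F': "para_holomorphic_on D F" and FM: "\<And>p. p \<in> M \<Longrightarrow> F p = f p"
    using F by (auto simp: para_holomorphic_extension_def)
  have "ck_on (Suc 0) D F"
    using F' unfolding para_holomorphic_on_def smooth_on_def by blast
  note dF = ck_on_SucD(1)[OF this]
  have "(fst \<circ> F) (ab_segment z 1) = (fst \<circ> F) (proj z)"
    \<comment> \<open>Removing the factor 1 gives the endpoint the shape \<open>p + r e\<close> of
      \<open>eq_along_segment\<close>; folding afterwards turns the intermediate points back into
      \<open>ab_segment z t\<close>.\<close>
    unfolding ab_segment_def scaleR_one
  proof (rule eq_along_segment; fold ab_segment_def)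
    fix t :: real assume "t \<in> {0..1}"
    then have t: "ab_segment z t \<in> D" by (rule ab)
    show "fst \<circ> F differentiable at (ab_segment z t)"
      unfolding comp_def differentiable_def using has_derivative_fst[OF dF[OF t]] by blast
    show "field_deriv (\<lambda>_. ((0, 0), (1, 0))) (fst \<circ> F) (ab_segment z t) = 0"
      using F' t by (simp add: para_holomorphic_on_def)
  qed
  moreover have "(snd \<circ> F) (xy_segment z 1) = (snd \<circ> F) (proj z)"
    unfolding xy_segment_def scaleR_one
  proof (rule eq_along_segment; fold xy_segment_def)
    fix t :: real assume "t \<in> {0..1}"
    then have t: "xy_segment z t \<in> D" by (rule xy)
    show "snd \<circ> F differentiable at (xy_segment z t)"
      unfolding comp_def differentiable_def using has_derivative_snd[OF dF[OF t]] by blast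
    show "field_deriv (\<lambda>_. ((0, 1), (0, 0))) (snd \<circ> F) (xy_segment z t) = 0"
      using F' t by (simp add: para_holomorphic_on_def)
  qed
  moreover have "graph_param \<phi> (foot z) \<in> M" "graph_param \<phi> (snd z) \<in> M"
    using foot_in_U[OF z] z base_in_U by (auto intro!: graph_param_in_M simp: prod_eq_iff) (cases z; auto)
  ultimately show ?thesis
    by (simp add: ab_segment_1 xy_segment_1 FM u_def v_def prod_eq_iff)
qed

text \<open>\<open>D1 \<inter> D2\<close> need not contain the segments to \<open>M\<close>, so
  \<open>W\<close> is taken as the image of those lifts whose two segments stay inside it. This set
  of lifts is open by compactness of the unit interval.\<close>

lemma extension_unique:
  assumes F1: "para_holomorphic_extension M f D1 F1" and F2: "para_holomorphic_extension M f D2 F2"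
  shows "\<exists>W. open W \<and> M \<subseteq> W \<and> W \<subseteq> D1 \<inter> D2 \<and> (\<forall>p\<in>W. F1 p = F2 p)"
proof -
  have D: "open (D1 \<inter> D2)" "M \<subseteq> D1 \<inter> D2"
    using F1 F2 by (auto simp: para_holomorphic_extension_def)
  define S where "S = {z \<in> lifts. \<forall>t\<in>{0..1}. ab_segment z t \<in> D1 \<inter> D2} \<inter>
    {z \<in> lifts. \<forall>t\<in>{0..1}. xy_segment z t \<in> D1 \<inter> D2}"
  have proj: "continuous_on (lifts \<times> {0..1::real}) (\<lambda>w. proj (fst w))"
    by (rule continuous_on_compose2[OF continuous_on_proj]) (auto intro: continuous_intros)
  have "continuous_on U height"
    using ck_on_height[of 0] by simp
  then have "continuous_on (lifts \<times> {0..1::real}) (\<lambda>w. height (foot (fst w)))"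
    "continuous_on (lifts \<times> {0..1::real}) (\<lambda>w. height (snd (fst w)))"
    by (rule continuous_on_compose2; use foot_in_U base_in_U in
        \<open>force intro: continuous_intros bounded_linear.continuous_on[OF bounded_linear_foot]\<close>)+
  then have "open S"
    unfolding S_def ab_segment_def xy_segment_def
    by (intro open_Int open_all_compact open_lifts D(1) compact_Icc)
      (unfold case_prod_unfold, intro continuous_intros proj; assumption)+
  have SD: "proj z \<in> D1 \<inter> D2" if "z \<in> S" for z
  proof -
    \<comment> \<open>The segment starts at \<open>proj z\<close> itself.\<close>
    have "ab_segment z 0 \<in> D1 \<inter> D2" using that unfolding S_def by force
    then show ?thesis by (simp add: ab_segment_def flip: zero_prod_def)
  qed
  have "open (proj ` S)"
    using \<open>open S\<close> by (rule open_proj_image) (auto simp: S_def)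
  moreover have "M \<subseteq> proj ` S"
  proof
    fix p assume p: "p \<in> M"
    then obtain a b x where p': "p = ((x, height (a, b, x)), (a, b))" "(a, b, x) \<in> U"
      unfolding M_eq by blast
    have "proj (a, a, b, x) = p" by (simp add: proj_def p')
    \<comment> \<open>For \<open>s = a\<close> both segments degenerate to the single point
      \<open>p\<close>.\<close>
    moreover have "(a, a, b, x) \<in> S"
      using p D(2) p'(1) trivial_lift[OF p'(2)]
      by (auto simp: S_def ab_segment_def xy_segment_def foot_def proj_def)
    ultimately show "p \<in> proj ` S" by blast
  qed
  moreover have "proj ` S \<subseteq> D1 \<inter> D2"
    using SD by blast
  moreover have "F1 (proj z) = F2 (proj z)" if "z \<in> S" for z
    using that para_holomorphic_extension_proj[OF F1, of z] para_holomorphic_extension_proj[OF F2, of z]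
    by (simp add: S_def)
  ultimately show ?thesis by blast
qed

end

theorem proposition3:
  fixes M :: "ambient set" and U :: "coords set" and \<phi> :: "coords \<Rightarrow> real"
    and f :: "ambient \<Rightarrow> real \<times> real"
  assumes "embedded_para_CR M U \<phi>"
    and "para_CR_function U \<phi> f"
  shows "(\<exists>D F. para_holomorphic_extension M f D F) \<and>
    (\<forall>D1 F1 D2 F2.
       para_holomorphic_extension M f D1 F1 \<longrightarrow> para_holomorphic_extension M f D2 F2 \<longrightarrow>
       (\<exists>W. open W \<and> M \<subseteq> W \<and> W \<subseteq> D1 \<inter> D2 \<and> (\<forall>p\<in>W. F1 p = F2 p)))"
proof -
  interpret para_CR_map M U \<phi> f
    using assms by unfold_locales
  show ?thesis using extension_exists extension_unique by blast
qed

end
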